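(* Let $\delta\in\mathbb{C}$ and let $(N,\cdot,\circ)$ be a $\delta$-Novikov--Poisson algebra over $\mathbb{C}$. For any fixed element $h\in N$, define a new operation $\times$ on $N$ by $$x\times y=x\circ y+hxy.$$ Then $(N,\cdot,\times)$ is a $\delta$-Novikov--Poisson algebra.
   Context: A (left) $\delta$-Novikov algebra is an algebra $(N,\circ)$ satisfying $\delta(x\circ y)\circ z-x\circ(y\circ z)=\delta(y\circ x)\circ z-y\circ(x\circ z)$ and $(x\circ y)\circ z=(x\circ z)\circ y$. A $\delta$-Novikov--Poisson algebra is a vector space $N$ with two bilinear operations $\cdot$ (also written by juxtaposition) and $\circ$ such that $(N,\cdot)$ is a commutative associative algebra, $(N,\circ)$ is a $\delta$-Novikov algebra, and for all $x,y,z\in N$: $(xy)\circ z=x(y\circ z)$ and $\delta(x\circ y)z-x\circ(yz)=\delta(y\circ x)z-y\circ(xz)$. *)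

theory Defs
  imports Complex_Main
begin

text \<open>Algebras here are not assumed to be associative, commutative or unital.\<close>

locale nonassoc_algebra = vector_space scale
  for scale :: "'k::field \<Rightarrow> 'a::ab_group_add \<Rightarrow> 'a" +
  fixes prod :: "'a \<Rightarrow> 'a \<Rightarrow> 'a"
  assumes linear_left: "\<And>y. Vector_Spaces.linear scale scale (\<lambda>x. prod x y)"
    and linear_right: "\<And>x. Vector_Spaces.linear scale scale (\<lambda>y. prod x y)"

locale comm_assoc_algebra = nonassoc_algebra scale prod
  for scale :: "'k::field \<Rightarrow> 'a::ab_group_add \<Rightarrow> 'a"
    and prod :: "'a \<Rightarrow> 'a \<Rightarrow> 'a" +
  assumes assoc: "\<And>x y z. prod (prod x y) z = prod x (prod y z)"
    and commute: "\<And>x y. prod x y = prod y x"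

locale delta_novikov_algebra = nonassoc_algebra scale circ
  for scale :: "'k::field \<Rightarrow> 'a::ab_group_add \<Rightarrow> 'a"
    and \<delta> :: 'k
    and circ :: "'a \<Rightarrow> 'a \<Rightarrow> 'a" (infixl "\<circ>\<^sub>N" 70) +
  assumes delta_left_symmetric:
      "\<And>x y z. scale \<delta> ((x \<circ>\<^sub>N y) \<circ>\<^sub>N z) - x \<circ>\<^sub>N (y \<circ>\<^sub>N z)
             = scale \<delta> ((y \<circ>\<^sub>N x) \<circ>\<^sub>N z) - y \<circ>\<^sub>N (x \<circ>\<^sub>N z)"
    and right_commutative: "\<And>x y z. (x \<circ>\<^sub>N y) \<circ>\<^sub>N z = (x \<circ>\<^sub>N z) \<circ>\<^sub>N y"

locale delta_novikov_poisson_algebra =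
  dot: comm_assoc_algebra scale dot + circ: delta_novikov_algebra scale \<delta> circ
  for scale :: "'k::field \<Rightarrow> 'a::ab_group_add \<Rightarrow> 'a"
    and \<delta> :: 'k
    and dot :: "'a \<Rightarrow> 'a \<Rightarrow> 'a" (infixl "\<cdot>\<^sub>N" 70)
    and circ :: "'a \<Rightarrow> 'a \<Rightarrow> 'a" (infixl "\<circ>\<^sub>N" 70) +
  assumes dot_circ: "\<And>x y z. (x \<cdot>\<^sub>N y) \<circ>\<^sub>N z = x \<cdot>\<^sub>N (y \<circ>\<^sub>N z)"
    and delta_compatible:
      "\<And>x y z. scale \<delta> ((x \<circ>\<^sub>N y) \<cdot>\<^sub>N z) - x \<circ>\<^sub>N (y \<cdot>\<^sub>N z)
             = scale \<delta> ((y \<circ>\<^sub>N x) \<cdot>\<^sub>N z) - y \<circ>\<^sub>N (x \<cdot>\<^sub>N z)"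

end

theory Submission
  imports Defs
begin

text \<open>
  Every identity for the deformed product splits by bilinearity into three parts: the
  same identity for the original circle product, terms that contain \<open>h\<close> and one circle
  product, and terms in the dot product alone, which are symmetric in the factors other than \<open>h\<close>.
  Only the middle part needs an idea.  Since the dot product is commutative, \<open>dot_circ\<close>
  makes \<open>x (y \<circ> z)\<close> symmetric in \<open>x\<close> and \<open>y\<close>.  This exchange law gives right
  commutativity and handles all middle terms of the left-symmetric identity except
  \<open>\<delta> h (x \<circ> y) z - x \<circ> (h y z)\<close>.  That expression is symmetric in \<open>x\<close> and \<open>y\<close> because it is the
  compatibility condition with \<open>h z\<close> in place of \<open>z\<close>.
\<close>

lemma (in nonassoc_algebra)
  shows prod_add_left: "prod (x + y) z = prod x z + prod y z"
    and prod_add_right: "prod x (y + z) = prod x y + prod x z"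
    and prod_scale_left: "prod (scale c x) y = scale c (prod x y)"
    and prod_scale_right: "prod x (scale c y) = scale c (prod x y)"
  using linear_left[of z] linear_left[of y] linear_right[of x]
  by (auto simp: Vector_Spaces.linear_iff)

lemma (in comm_assoc_algebra) left_commute: "prod x (prod y z) = prod y (prod x z)"
  by (metis assoc commute)

context delta_novikov_poisson_algebra
begin

text \<open>Both sides equal the circle product of the dot product of \<open>x\<close> and \<open>y\<close> with \<open>z\<close>.\<close>

lemma dot_circ_exchange: "x \<cdot>\<^sub>N (y \<circ>\<^sub>N z) = y \<cdot>\<^sub>N (x \<circ>\<^sub>N z)"
  by (metis dot_circ dot.commute)

text \<open>
  Compatibility absorbs \<open>h\<close> into its third argument.  The factor \<open>h\<close> is pulled to the front
  so that the terms appear as in the expanded associator of the deformed product.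
\<close>

lemma compatible_absorb:
  "scale \<delta> (h \<cdot>\<^sub>N ((x \<circ>\<^sub>N y) \<cdot>\<^sub>N z)) - x \<circ>\<^sub>N (h \<cdot>\<^sub>N (y \<cdot>\<^sub>N z))
    = scale \<delta> (h \<cdot>\<^sub>N ((y \<circ>\<^sub>N x) \<cdot>\<^sub>N z)) - y \<circ>\<^sub>N (h \<cdot>\<^sub>N (x \<cdot>\<^sub>N z))"
  using delta_compatible[of x y "h \<cdot>\<^sub>N z"] by (simp only: dot.left_commute)

abbreviation deformed_circ :: "'a \<Rightarrow> 'a \<Rightarrow> 'a \<Rightarrow> 'a"
  where "deformed_circ h x y \<equiv> x \<circ>\<^sub>N y + h \<cdot>\<^sub>N (x \<cdot>\<^sub>N y)"

lemma deformed_circ_assoc_left: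
  "deformed_circ h (deformed_circ h x y) z
    = (x \<circ>\<^sub>N y) \<circ>\<^sub>N z + h \<cdot>\<^sub>N (x \<cdot>\<^sub>N (y \<circ>\<^sub>N z)) + h \<cdot>\<^sub>N ((x \<circ>\<^sub>N y) \<cdot>\<^sub>N z)
      + h \<cdot>\<^sub>N (h \<cdot>\<^sub>N (x \<cdot>\<^sub>N (y \<cdot>\<^sub>N z)))"
  by (simp add: circ.prod_add_left dot.prod_add_left dot.prod_add_right dot_circ dot.assoc add.assoc)

lemma deformed_circ_assoc_right:
  "deformed_circ h x (deformed_circ h y z)
    = x \<circ>\<^sub>N (y \<circ>\<^sub>N z) + x \<circ>\<^sub>N (h \<cdot>\<^sub>N (y \<cdot>\<^sub>N z)) + h \<cdot>\<^sub>N (x \<cdot>\<^sub>N (y \<circ>\<^sub>N z))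
      + h \<cdot>\<^sub>N (h \<cdot>\<^sub>N (x \<cdot>\<^sub>N (y \<cdot>\<^sub>N z)))"
  by (simp add: circ.prod_add_right dot.prod_add_right add.assoc dot.left_commute[of x h])

lemma deformed_circ_right_commutative:
  "deformed_circ h (deformed_circ h x y) z = deformed_circ h (deformed_circ h x z) y"
proof -
  \<comment> \<open>Exchanging \<open>y\<close> and \<open>z\<close> swaps the two terms that mix the products.\<close>
  have swap: "x \<cdot>\<^sub>N (v \<circ>\<^sub>N w) = (x \<circ>\<^sub>N w) \<cdot>\<^sub>N v" for v w
    by (metis dot_circ_exchange dot.commute)
  show ?thesis
    unfolding deformed_circ_assoc_left swap circ.right_commutative[of x y z] dot.commute[of y z]
    by (simp add: algebra_simps)
qed

lemma deformed_circ_left_symmetric: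
  "scale \<delta> (deformed_circ h (deformed_circ h x y) z) - deformed_circ h x (deformed_circ h y z)
    = scale \<delta> (deformed_circ h (deformed_circ h y x) z) - deformed_circ h y (deformed_circ h x z)"
proof -
  \<comment> \<open>The exchange law makes the terms \<open>p\<close> and \<open>p'\<close> agree on both sides; \<open>q\<close> and \<open>r\<close>
    stand for the pure dot terms.\<close>
  have sum_of_identities: "a + p + b + r - (c + d + p' + q) = a' + p + b' + r - (c' + d' + p' + q)"
    if "a - c = a' - c'" "b - d = b' - d'" for a a' b b' c c' d d' p p' q r :: 'a
  proof -
    have "a + p + b + r - (c + d + p' + q) = (a - c) + (b - d) + (p + r - p' - q)"
      by (simp add: algebra_simps)
    also have "\<dots> = a' + p + b' + r - (c' + d' + p' + q)"
      unfolding that by (simp add: algebra_simps)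
    finally show ?thesis .
  qed
  show ?thesis
    unfolding deformed_circ_assoc_left deformed_circ_assoc_right dot.scale_right_distrib
      dot_circ_exchange[of y x z] dot.left_commute[of y x z]
    by (rule sum_of_identities[OF circ.delta_left_symmetric compatible_absorb])
qed

lemma deformed_circ_compatible:
  "scale \<delta> (deformed_circ h x y \<cdot>\<^sub>N z) - deformed_circ h x (y \<cdot>\<^sub>N z)
    = scale \<delta> (deformed_circ h y x \<cdot>\<^sub>N z) - deformed_circ h y (x \<cdot>\<^sub>N z)"
  using delta_compatible[of x y z]
  by (simp add: dot.prod_add_left dot.scale_right_distrib dot.assoc dot.left_commute[of x y z]
      algebra_simps)

lemma deformed_circ_dot: "deformed_circ h (x \<cdot>\<^sub>N y) z = x \<cdot>\<^sub>N deformed_circ h y z"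
  by (simp add: dot_circ dot.prod_add_right dot.assoc dot.left_commute[of x h])

lemma nonassoc_algebra_deformed_circ: "nonassoc_algebra scale (deformed_circ h)"
  by unfold_locales
    (simp_all add: circ.prod_add_left circ.prod_add_right circ.prod_scale_left
      circ.prod_scale_right dot.prod_add_left dot.prod_add_right dot.prod_scale_left
      dot.prod_scale_right dot.scale_right_distrib dot.scale_left_distrib algebra_simps)

lemma delta_novikov_poisson_deformed_circ:
  "delta_novikov_poisson_algebra scale \<delta> dot (deformed_circ h)"
proof -
  interpret deformed: nonassoc_algebra scale "deformed_circ h"
    by (rule nonassoc_algebra_deformed_circ)
  show ?thesis
    by unfold_locales
      (fact deformed_circ_left_symmetric deformed_circ_right_commutative deformed_circ_dot
        deformed_circ_compatible)+
qed

end

theorem lemma22: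
  fixes scale :: "complex \<Rightarrow> 'a::ab_group_add \<Rightarrow> 'a"
    and \<delta> :: complex
    and dot circ :: "'a \<Rightarrow> 'a \<Rightarrow> 'a"
    and h :: 'a
  assumes "delta_novikov_poisson_algebra scale \<delta> dot circ"
  shows "delta_novikov_poisson_algebra scale \<delta> dot (\<lambda>x y. circ x y + dot h (dot x y))"
  using assms by (rule delta_novikov_poisson_algebra.delta_novikov_poisson_deformed_circ)

end
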